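(* Let $f\colon T\times X\to\overline{\mathbb{R}}$ be an admissible integrand and let $m_f(t):=\inf_{x\in X}f_t(x)$. Let $A\in\mathcal{A}$ be such that there exists a measurable function $\alpha\colon A\to\overline{\mathbb{R}}$ with $m_f(t)<\alpha(t)$ for all $t\in A$. Then there exists a strongly measurable function $x\colon A\to X$ such that $f_t(x(t))\le\alpha(t)$ for $\mu$-a.e. $t\in A$.
   Context: Standing assumptions: $X$ is a (not necessarily separable) Banach space, $(T,d)$ is a metric space, and $(T,\mathcal{A},\mu)$ is a complete $\sigma$-finite measure space with $\mathcal{A}$ containing the Borel $\sigma$-algebra of $T$; $\mu$ is inner regular, meaning that for all $\varepsilon>0$ and $B\in\mathcal{A}$ of finite measure there is a compact $K\subset B$ with $\mu(B\setminus K)<\varepsilon$. Notation: $\overline{\mathbb{R}}=[-\infty,\infty]$; $f_t(x):=f(t,x)$; $\operatorname{epi} g:=\{(x,\alpha)\in X\times\mathbb{R}: g(x)\le\alpha\}$. A function is strongly measurable if it is the pointwise limit of simple functions (functions $\sum_{k=1}^n x_k\mathbf{1}_{A_k}$ with $A_k\in\mathcal{A}$ disjoint, $x_k\in X$). A multifunction $\Phi$ is lower semicontinuous (lsc) at $t$ if for every open $V$ with $\Phi(t)\cap V\ne\emptyset$ there is a neighbourhood $U$ of $t$ with $\Phi(s)\cap V\neq\emptyset$ for all $s\in U$; it is lsc if it is lsc at every point where its value is nonempty. A family $(f^i\colon T\times X\to\overline{\mathbb{R}})_{i\in I}$ is a uniform Lusin family if for every $\varepsilon>0$ and every $A\in\mathcal{A}$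 of finite measure there is a compact $B\subset A$ with $\mu(A\setminus B)<\varepsilon$ such that $B\ni t\rightrightarrows\operatorname{epi} f^i_t$ is lsc for all $i\in I$. $\Gamma(X)$ is the set of convex lower semicontinuous functions $X\to\overline{\mathbb{R}}$ (functions with closed convex epigraph, not necessarily proper). A function $f\colon T\times X\to\overline{\mathbb{R}}$ is an admissible integrand if there is a uniform Lusin family $(f^i)_{i\in I}$ with $f^i_t\in\Gamma(X)$ for all $i\in I$, $t\in T$, and $\operatorname{epi} f_t=\operatorname{cl}\big(\operatorname{epi}(\inf_{i\in I}f^i_t)\big)$ for all $t\in T$. *)

theory Defs
  imports "HOL-Analysis.Analysis"
begin

definition inner_regular :: "'t::metric_space measure \<Rightarrow> bool" where
  "inner_regular M \<longleftrightarrow>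
     (\<forall>\<epsilon>::real. \<forall>B. \<epsilon> > 0 \<and> B \<in> sets M \<and> emeasure M B < \<infinity> \<longrightarrow>
        (\<exists>K. compact K \<and> K \<subseteq> B \<and> emeasure M (B - K) < ennreal \<epsilon>))"

(* Strong measurability on all of space M; for a function defined on a measurable set A only,
   take restrict_space M A. Simple functions take finitely many values, each on a measurable set
   of possibly infinite measure. *)
definition strongly_measurable :: "'t measure \<Rightarrow> ('t \<Rightarrow> 'x::topological_space) \<Rightarrow> bool" where
  "strongly_measurable M g \<longleftrightarrow>
     (\<exists>s :: nat \<Rightarrow> 't \<Rightarrow> 'x. (\<forall>n. simple_function M (s n)) \<and>
        (\<forall>t\<in>space M. (\<lambda>n. s n t) \<longlonglongrightarrow> g t))"

(* The library's epigraph is for real-valued functions only. *)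
definition epi :: "('x \<Rightarrow> ereal) \<Rightarrow> ('x \<times> real) set" where
  "epi g = {(x, \<alpha>). g x \<le> ereal \<alpha>}"

definition multi_lsc_at ::
    "'t::topological_space set \<Rightarrow> ('t \<Rightarrow> 'y::topological_space set) \<Rightarrow> 't \<Rightarrow> bool" where
  "multi_lsc_at B \<Phi> t \<longleftrightarrow>
     (\<forall>V. open V \<and> \<Phi> t \<inter> V \<noteq> {} \<longrightarrow>
        (\<exists>U. openin (top_of_set B) U \<and> t \<in> U \<and> (\<forall>s\<in>U. \<Phi> s \<inter> V \<noteq> {})))"

(* Lower semicontinuity of the multifunction restricted to the subspace B. *)
definition multi_lsc_on ::
    "'t::topological_space set \<Rightarrow> ('t \<Rightarrow> 'y::topological_space set) \<Rightarrow> bool" where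
  "multi_lsc_on B \<Phi> \<longleftrightarrow> (\<forall>t\<in>B. \<Phi> t \<noteq> {} \<longrightarrow> multi_lsc_at B \<Phi> t)"

definition uniform_lusin_family ::
    "'t::metric_space measure \<Rightarrow> 'i set \<Rightarrow> ('i \<Rightarrow> 't \<Rightarrow> 'x::banach \<Rightarrow> ereal) \<Rightarrow> bool" where
  "uniform_lusin_family M I f \<longleftrightarrow>
     (\<forall>\<epsilon>::real. \<forall>A. \<epsilon> > 0 \<and> A \<in> sets M \<and> emeasure M A < \<infinity> \<longrightarrow>
        (\<exists>B. compact B \<and> B \<subseteq> A \<and> emeasure M (A - B) < ennreal \<epsilon> \<and>
           (\<forall>i\<in>I. multi_lsc_on B (\<lambda>t. epi (f i t)))))"

definition Gamma :: "('x::banach \<Rightarrow> ereal) set" where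
  "Gamma = {g. closed (epi g) \<and> convex (epi g)}"

(* HOL cannot quantify existentially over the type of the index set I. Since every condition
   depends only on the range of the family, it is enough to take indices in the type of integrands
   itself; the lemma below shows that this loses no family, whatever its index type. *)
definition admissible_integrand ::
    "'t::metric_space measure \<Rightarrow> ('t \<Rightarrow> 'x::banach \<Rightarrow> ereal) \<Rightarrow> bool" where
  "admissible_integrand M f \<longleftrightarrow>
     (\<exists>(I :: ('t \<Rightarrow> 'x \<Rightarrow> ereal) set) (fam :: ('t \<Rightarrow> 'x \<Rightarrow> ereal) \<Rightarrow> 't \<Rightarrow> 'x \<Rightarrow> ereal).
        uniform_lusin_family M I fam \<and>
        (\<forall>i\<in>I. \<forall>t. fam i t \<in> Gamma) \<and>
        (\<forall>t. epi (f t) = closure (epi (\<lambda>x. INF i\<in>I. fam i t x))))"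

lemma admissible_integrandI:
  fixes I :: "'i set" and fam :: "'i \<Rightarrow> 't::metric_space \<Rightarrow> 'x::banach \<Rightarrow> ereal"
  assumes "uniform_lusin_family M I fam"
    and "\<And>i t. i \<in> I \<Longrightarrow> fam i t \<in> Gamma"
    and "\<And>t. epi (f t) = closure (epi (\<lambda>x. INF i\<in>I. fam i t x))"
  shows "admissible_integrand M f"
  unfolding admissible_integrand_def
proof (intro exI conjI)
  show "uniform_lusin_family M (fam ` I) (\<lambda>g. g)"
    using assms(1) by (simp add: uniform_lusin_family_def)
  show "\<forall>g\<in>fam ` I. \<forall>t. g t \<in> Gamma"
    using assms(2) by blast
  show "\<forall>t. epi (f t) = closure (epi (\<lambda>x. INF g\<in>fam ` I. g t x))"
    using assms(3) by (simp add: image_image)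
qed

definition m_inf :: "('t \<Rightarrow> 'x \<Rightarrow> ereal) \<Rightarrow> 't \<Rightarrow> ereal" where
  "m_inf f t = (INF x. f t x)"

end

theory Submission
  imports Defs
begin

text \<open>
  Write \<open>g t x\<close> for the infimum over the Lusin family at \<open>(t, x)\<close>. Since \<open>epi (f t)\<close> is the
  closure of \<open>epi (g t)\<close>, the infima of \<open>f t\<close> and \<open>g t\<close> over \<open>x\<close> agree (\<open>closure_epi_Inf_iff\<close>), so the strict sublevel set
  \<open>\<Phi> t = {x. \<exists>i. fam i t x < \<alpha> t}\<close> is nonempty for \<open>t \<in> A\<close>; and as \<open>epi (f t)\<close> is closed,
  \<open>f t x \<le> \<alpha> t\<close> for every \<open>x\<close> in the closure of \<open>\<Phi> t\<close>
  (\<open>closure_strict_sublevel_le\<close>). It therefore suffices to find a strongly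
  measurable selection of the closure of \<open>\<Phi>\<close>, off a null set.

  The space \<open>X\<close> need not be separable, so the countability that the classical theorem of
  Kuratowski and Ryll-Nardzewski draws from \<open>X\<close> has to come from \<open>T\<close>. By sigma-finiteness, almost
  all of \<open>A\<close> is a countable union of compact sets \<open>B n\<close> on which all \<open>epi (fam i t)\<close> are lsc, and a
  compact metric space has a countable base. Intersecting basic sets of \<open>B n\<close> with the sets
  \<open>{\<alpha> > q}\<close>, \<open>q\<close> rational, gives a countable family of measurable sets that plays the role of a
  base for which \<open>\<Phi>\<close> is lsc: if \<open>y \<in> \<Phi> t\<close>, then some member containing \<open>t\<close> consists of points \<open>s\<close>
  for which \<open>\<Phi> s\<close> comes close to \<open>y\<close>. The rational \<open>q\<close> between \<open>fam i t y\<close> and \<open>\<alpha> t\<close> decouples the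
  topological condition on the integrand from the purely measurable condition on \<open>\<alpha>\<close>.

  The selection is then the limit of countably valued measurable functions \<open>h n\<close> whose value at \<open>t\<close>
  lies within \<open>2\<^sup>-\<^sup>n\<close> of \<open>\<Phi> t\<close> and within \<open>2\<^sup>-\<^sup>n\<close> of the next value
  (\<open>measurable_selection_of_closure\<close>), and such limits are strongly measurable
  (\<open>strongly_measurable_limit_countably_valued\<close>).
\<close>

section \<open>Limits of countably valued measurable functions\<close>

primrec latest_value_in :: "'x set \<Rightarrow> (nat \<Rightarrow> 't \<Rightarrow> 'x) \<Rightarrow> nat \<Rightarrow> 't \<Rightarrow> 'x" where
  "latest_value_in F h 0 t = undefined"
| "latest_value_in F h (Suc m) t = (if h m t \<in> F then h m t else latest_value_in F h m t)"

lemma latest_value_in_ge: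
  assumes "j < m" "h j t \<in> F"
  shows "\<exists>k\<ge>j. latest_value_in F h m t = h k t"
proof (use assms in \<open>induction m\<close>)
  case (Suc m)
  show ?case
  proof (cases "h m t \<in> F")
    case True
    with Suc.prems(1) show ?thesis
      by (intro exI[of _ m]) auto
  next
    case False
    with Suc have "j \<noteq> m"
      by auto
    with Suc False show ?thesis
      by simp
  qed
qed simp

lemma simple_function_latest_value_in:
  assumes "finite F" and h: "\<And>n. h n \<in> measurable N (count_space UNIV)"
  shows "simple_function N (latest_value_in F h m)"
proof -
  have "latest_value_in F h m ` space N \<subseteq> insert undefined F"
    by (induction m) auto
  hence fin: "finite (latest_value_in F h m ` space N)"
    using \<open>finite F\<close> finite_subset by blast
  have "latest_value_in F h m \<in> measurable N (count_space UNIV)"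
  proof (induction m)
    case (Suc m)
    have "(\<lambda>x. x \<in> F) \<in> measurable (count_space UNIV) (count_space UNIV)"
      by simp
    from measurable_compose[OF h this] have "Measurable.pred N (\<lambda>t. h m t \<in> F)" .
    with Suc show ?case
      using h by simp
  qed simp
  with fin show ?thesis
    by (auto simp: simple_function_def)
qed

text \<open>
  Truncating \<open>h n\<close> to its first \<open>n\<close> values would not converge, as \<open>h n t\<close> may be listed later
  for each \<open>n\<close>. But each single value \<open>h j t\<close> is among the first \<open>n\<close> values for all large \<open>n\<close>,
  so the last one that is admitted at stage \<open>n\<close> has an index that tends to infinity.
\<close>
lemma strongly_measurable_limit_countably_valued:
  fixes h :: "nat \<Rightarrow> 't \<Rightarrow> 'x::topological_space"
  assumes h: "\<And>n. h n \<in> measurable N (count_space UNIV)"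
    and cnt: "\<And>n. countable (h n ` space N)"
    and lim: "\<And>t. t \<in> space N \<Longrightarrow> (\<lambda>n. h n t) \<longlonglongrightarrow> g t"
  shows "strongly_measurable N g"
proof -
  define D where "D = (\<Union>n. h n ` space N)"
  have "countable D"
    using cnt by (simp add: D_def)
  define F where "F n = {y \<in> D. to_nat_on D y \<le> n}" for n
  have fin: "finite (F n)" for n
  proof (rule finite_imageD)
    show "finite (to_nat_on D ` F n)"
      by (rule finite_subset[of _ "{..n}"]) (auto simp: F_def)
    show "inj_on (to_nat_on D) (F n)"
      using inj_on_to_nat_on[OF \<open>countable D\<close>] by (rule inj_on_subset) (auto simp: F_def)
  qed
  define s where "s n = latest_value_in (F n) h n" for n
  have "(\<lambda>n. s n t) \<longlonglongrightarrow> g t" if t: "t \<in> space N" for t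
  proof (rule topological_tendstoI)
    fix V assume "open V" "g t \<in> V"
    with lim[OF t] have "eventually (\<lambda>n. h n t \<in> V) sequentially"
      by (rule topological_tendstoD)
    then obtain j where j: "\<And>k. k \<ge> j \<Longrightarrow> h k t \<in> V"
      by (auto simp: eventually_sequentially)
    have "s n t \<in> V" if n: "n \<ge> max (Suc j) (to_nat_on D (h j t))" for n
    proof -
      have "h j t \<in> F n"
        using n t by (auto simp: F_def D_def)
      with n have "\<exists>k\<ge>j. s n t = h k t"
        unfolding s_def by (intro latest_value_in_ge) auto
      with j show ?thesis
        by auto
    qed
    thus "eventually (\<lambda>n. s n t \<in> V) sequentially"
      unfolding eventually_sequentially by blast
  qed
  moreover have "simple_function N (s n)" for n
    unfolding s_def by (rule simple_function_latest_value_in[OF fin h])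
  ultimately show ?thesis
    unfolding strongly_measurable_def by blast
qed

section \<open>Measurable selections without separability of the range\<close>

text \<open>
  The new value at \<open>t\<close> depends only on the old one and on the first set \<open>b k\<close> around \<open>t\<close> on which a
  common approximate point of \<open>\<Phi>\<close> exists that is \<open>R\<close>-related to the old value. Hence it takes
  countably many values, measurably. With \<open>R\<close> trivial this starts the approximation; with \<open>R\<close>
  bounding a distance it refines it.
\<close>
lemma countably_valued_refinement:
  fixes \<Phi> :: "'t \<Rightarrow> 'x::metric_space set" and b :: "nat \<Rightarrow> 't set" and h :: "'t \<Rightarrow> 'c"
  assumes b: "\<And>k. b k \<in> sets N"
    and lsc: "\<And>t y e. t \<in> space N \<Longrightarrow> y \<in> \<Phi> t \<Longrightarrow> e > 0 \<Longrightarrow>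
                \<exists>k. t \<in> b k \<and> (\<forall>s\<in>b k. \<Phi> s \<inter> ball y e \<noteq> {})"
    and h: "h \<in> measurable N (count_space UNIV)" "countable (h ` space N)"
    and R: "\<And>t. t \<in> space N \<Longrightarrow> \<exists>y\<in>\<Phi> t. R (h t) y"
    and "d > 0"
  obtains h' where "h' \<in> measurable N (count_space UNIV)" "countable (h' ` space N)"
    "\<And>t. t \<in> space N \<Longrightarrow> R (h t) (h' t) \<and> \<Phi> t \<inter> ball (h' t) d \<noteq> {}"
proof
  define Q where "Q k c y \<longleftrightarrow> R c y \<and> (\<forall>s\<in>b k. \<Phi> s \<inter> ball y d \<noteq> {})" for k c y
  define Y where "Y k c = (SOME y. Q k c y)" for k c
  define \<kappa> where "\<kappa> t = (LEAST k. t \<in> b k \<and> Ex (Q k (h t)))" for t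
  define h' where "h' t = Y (\<kappa> t) (h t)" for t
  have comp: "(\<lambda>t. F (h t)) \<in> measurable N (count_space UNIV)" for F :: "'c \<Rightarrow> 'd"
    by (rule measurable_compose[OF h(1)]) simp
  have "Measurable.pred N (\<lambda>t. t \<in> b k \<and> Ex (Q k (h t)))" for k
    using b[of k] comp[of "\<lambda>c. Ex (Q k c)"] by (intro pred_intros_logic) auto
  hence \<kappa>: "\<kappa> \<in> measurable N (count_space UNIV)"
    unfolding \<kappa>_def by (rule measurable_Least)
  show "h' \<in> measurable N (count_space UNIV)"
    unfolding h'_def by (rule measurable_compose_countable[OF comp \<kappa>])
  have "h' ` space N \<subseteq> (\<lambda>(k, c). Y k c) ` (UNIV \<times> h ` space N)"
    by (auto simp: h'_def)
  thus "countable (h' ` space N)"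
    by (rule countable_subset) (use h(2) in auto)
  show "R (h t) (h' t) \<and> \<Phi> t \<inter> ball (h' t) d \<noteq> {}" if t: "t \<in> space N" for t
  proof -
    obtain y where y: "y \<in> \<Phi> t" "R (h t) y"
      using R[OF t] by blast
    obtain k where "t \<in> b k" "\<forall>s\<in>b k. \<Phi> s \<inter> ball y d \<noteq> {}"
      using lsc[OF t y(1) \<open>d > 0\<close>] by blast
    hence "t \<in> b k \<and> Ex (Q k (h t))"
      using y(2) by (auto simp: Q_def)
    hence \<kappa>t: "t \<in> b (\<kappa> t)" "Ex (Q (\<kappa> t) (h t))"
      unfolding \<kappa>_def by (rule LeastI2; blast)+
    from \<kappa>t(2) have "Q (\<kappa> t) (h t) (h' t)"
      unfolding h'_def Y_def by (rule someI_ex)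
    with \<kappa>t(1) show ?thesis
      by (auto simp: Q_def)
  qed
qed

lemma dist_le_geometric:
  fixes u :: "nat \<Rightarrow> 'x::metric_space"
  assumes "\<And>n. dist (u n) (u (Suc n)) < (1/2)^n"
  shows "dist (u n) (u (n + k)) \<le> 2 * (1/2)^n - 2 * (1/2)^(n + k)"
proof (induction k)
  case (Suc k)
  have "dist (u n) (u (n + Suc k)) \<le> dist (u n) (u (n + k)) + dist (u (n + k)) (u (Suc (n + k)))"
    by (simp add: dist_triangle)
  also have "\<dots> \<le> 2 * (1/2)^n - 2 * (1/2)^(n + k) + (1/2)^(n + k)"
    using Suc assms[of "n + k"] by simp
  finally show ?case
    by simp
qed simp

lemma Cauchy_geometric_steps:
  fixes u :: "nat \<Rightarrow> 'x::metric_space"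
  assumes "\<And>n. dist (u n) (u (Suc n)) < (1/2)^n"
  shows "Cauchy u"
proof (rule metric_CauchyI)
  fix e :: real assume "e > 0"
  then obtain n where n: "(1/2::real)^n < e/4"
    using real_arch_pow_inv[of "e/4" "1/2"] by auto
  have near: "dist (u n) (u m) < e/2" if "m \<ge> n" for m
  proof -
    have "dist (u n) (u m) \<le> 2 * (1/2)^n - 2 * (1/2)^m"
      using dist_le_geometric[of u n "m - n"] assms that by simp
    moreover have "(1/2::real)^m > 0"
      by simp
    ultimately show ?thesis
      using n by linarith
  qed
  show "\<exists>k. \<forall>m\<ge>k. \<forall>m'\<ge>k. dist (u m) (u m') < e"
  proof (intro exI[of _ n] allI impI)
    fix m m' assume "m \<ge> n" "m' \<ge> n"
    with near show "dist (u m) (u m') < e"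
      by (metis dist_commute dist_triangle_half_r)
  qed
qed

text \<open>
  The hypothesis on \<open>b\<close> says that \<open>\<Phi>\<close> is lower semicontinuous with respect to a countable family of
  measurable sets. This countability on the side of the domain replaces the separability of the
  range in the theorem of Kuratowski and Ryll-Nardzewski. Each refinement can demand that
  the next value stay close to the present one, since a nearby point of \<open>\<Phi> t\<close> meets this demand;
  so the approximations are Cauchy.
\<close>
theorem measurable_selection_of_closure:
  fixes \<Phi> :: "'t \<Rightarrow> 'x::complete_space set" and b :: "nat \<Rightarrow> 't set"
  assumes b: "\<And>k. b k \<in> sets N"
    and lsc: "\<And>t y e. t \<in> space N \<Longrightarrow> y \<in> \<Phi> t \<Longrightarrow> e > 0 \<Longrightarrow>
                \<exists>k. t \<in> b k \<and> (\<forall>s\<in>b k. \<Phi> s \<inter> ball y e \<noteq> {})"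
    and ne: "\<And>t. t \<in> space N \<Longrightarrow> \<Phi> t \<noteq> {}"
  obtains g where "strongly_measurable N g" "\<And>t. t \<in> space N \<Longrightarrow> g t \<in> closure (\<Phi> t)"
proof -
  let ?P = "\<lambda>n (h :: 't \<Rightarrow> 'x). h \<in> measurable N (count_space UNIV) \<and> countable (h ` space N) \<and>
              (\<forall>t\<in>space N. \<Phi> t \<inter> ball (h t) ((1/2)^n) \<noteq> {})"
  let ?Q = "\<lambda>n (h :: 't \<Rightarrow> 'x) h'. \<forall>t\<in>space N. dist (h t) (h' t) < (1/2)^n"
  have "\<exists>h. \<forall>n. ?P n (h n) \<and> ?Q n (h n) (h (Suc n))"
  proof (rule dependent_nat_choice[of ?P ?Q])
    show "\<exists>h. ?P 0 h"
    proof (rule countably_valued_refinement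
        [of b N \<Phi> "\<lambda>_. undefined" "\<lambda>_ _. True" 1, OF b lsc])
      show "countable ((\<lambda>_. undefined :: 'x) ` space N)"
        by (rule countable_subset[of _ "{undefined}"]) auto
      show "\<exists>y\<in>\<Phi> t. True" if "t \<in> space N" for t
        using ne[OF that] by blast
    qed auto
  next
    fix h n assume h: "?P n h"
    show "\<exists>h'. ?P (Suc n) h' \<and> ?Q n h h'"
    proof (rule countably_valued_refinement
        [of b N \<Phi> h "\<lambda>c y. dist c y < (1/2)^n" "(1/2)^Suc n", OF b lsc])
      show "\<exists>y\<in>\<Phi> t. dist (h t) y < (1/2)^n" if "t \<in> space N" for t
        using h that by fastforce
    qed (use h in auto)
  qed
  then obtain h where "\<forall>n. ?P n (h n) \<and> ?Q n (h n) (h (Suc n))" ..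
  hence h: "?P n (h n)" "?Q n (h n) (h (Suc n))" for n
    by simp_all
  define g where "g t = lim (\<lambda>n. h n t)" for t
  have lim: "(\<lambda>n. h n t) \<longlonglongrightarrow> g t" if "t \<in> space N" for t
    unfolding g_def using Cauchy_geometric_steps[of "\<lambda>n. h n t"] h(2) that
    by (simp add: convergent_LIMSEQ_iff[symmetric] Cauchy_convergent)
  show ?thesis
  proof
    show "strongly_measurable N g"
      by (rule strongly_measurable_limit_countably_valued[of h]) (use h(1) lim in auto)
    fix t assume t: "t \<in> space N"
    have "\<exists>y. y \<in> \<Phi> t \<and> dist (h n t) y < (1/2)^n" for n
      using h(1)[of n] t by fastforce
    then obtain y where y: "\<And>n. y n \<in> \<Phi> t" "\<And>n. dist (h n t) (y n) < (1/2)^n"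
      by metis
    have "(\<lambda>n. (1/2::real)^n + dist (h n t) (g t)) \<longlonglongrightarrow> 0 + 0"
      using lim[OF t] by (intro tendsto_add LIMSEQ_realpow_zero) (auto simp: tendsto_dist_iff[symmetric])
    moreover have "dist (y n) (g t) \<le> (1/2)^n + dist (h n t) (g t)" for n
      using y(2)[of n] dist_triangle[of "y n" "g t" "h n t"] by (simp add: dist_commute)
    ultimately have "(\<lambda>n. dist (y n) (g t)) \<longlonglongrightarrow> 0"
      by (intro Lim_null_comparison[of "\<lambda>n. dist (y n) (g t)"] always_eventually) auto
    hence "y \<longlonglongrightarrow> g t"
      by (simp add: tendsto_dist_iff[symmetric])
    with y(1) show "g t \<in> closure (\<Phi> t)"
      unfolding closure_sequential by blast
  qed
qed

section \<open>Countably many compact sets and their bases\<close>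

lemma compact_countable_base:
  fixes B :: "'t::metric_space set"
  assumes "compact B"
  obtains \<B> where "countable \<B>" "\<And>b. b \<in> \<B> \<Longrightarrow> open b"
    "\<And>U t. openin (top_of_set B) U \<Longrightarrow> t \<in> U \<Longrightarrow> \<exists>b\<in>\<B>. t \<in> b \<and> b \<inter> B \<subseteq> U"
proof -
  have "\<exists>F. finite F \<and> B \<subseteq> (\<Union>x\<in>F. ball x (1 / Suc n))" for n
    by (rule compactE_image[OF assms, of B "\<lambda>x. ball x (1 / Suc n)"]) auto
  then obtain F where F: "\<And>n. finite (F n)" "\<And>n. B \<subseteq> (\<Union>x\<in>F n. ball x (1 / Suc n))"
    by metis
  let ?\<B> = "\<Union>n. (\<lambda>x. ball x (1 / Suc n)) ` F n"
  show ?thesis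
  proof
    show "countable ?\<B>"
      using F(1) by (simp add: countable_finite)
    show "open b" if "b \<in> ?\<B>" for b
      using that by auto
    fix U t assume U: "openin (top_of_set B) U" "t \<in> U"
    then obtain e where e: "e > 0" "ball t e \<inter> B \<subseteq> U" and "t \<in> B"
      unfolding openin_contains_ball by blast
    obtain n where n: "1 / real (Suc n) < e / 2"
      using \<open>e > 0\<close> nat_approx_posE[of "e/2"] by auto
    obtain x where x: "x \<in> F n" "t \<in> ball x (1 / Suc n)"
      using F(2) \<open>t \<in> B\<close> by blast
    have "ball x (1 / Suc n) \<subseteq> ball t e"
    proof
      fix s assume "s \<in> ball x (1 / Suc n)"
      hence "dist x t < e / 2" "dist x s < e / 2"
        using x(2) n by auto
      thus "s \<in> ball t e"
        by (metis dist_triangle_half_r mem_ball)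
    qed
    with e x show "\<exists>b\<in>?\<B>. t \<in> b \<and> b \<inter> B \<subseteq> U"
      by blast
  qed
qed

lemma uniform_lusin_family_exhaustion:
  fixes M :: "'t::metric_space measure" and fam :: "'i \<Rightarrow> 't \<Rightarrow> 'x::banach \<Rightarrow> ereal"
  assumes "sigma_finite_measure M" and borel: "sets borel \<subseteq> sets M"
    and lusin: "uniform_lusin_family M I fam" and A: "A \<in> sets M"
  obtains \<K> where "countable \<K>"
    "\<And>B. B \<in> \<K> \<Longrightarrow> compact B \<and> B \<subseteq> A \<and> (\<forall>i\<in>I. multi_lsc_on B (\<lambda>t. epi (fam i t)))"
    "A - \<Union>\<K> \<in> null_sets M"
proof -
  interpret sigma_finite_measure M by fact
  obtain S :: "nat \<Rightarrow> 't set" where S: "range S \<subseteq> sets M" "(\<Union>m. S m) = space M"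
    "\<And>m. emeasure M (S m) \<noteq> \<infinity>"
    using sigma_finite by blast
  have fin: "emeasure M (A \<inter> S m) < \<infinity>" for m
  proof -
    have "emeasure M (A \<inter> S m) \<le> emeasure M (S m)"
      using S(1) A by (intro emeasure_mono) auto
    thus ?thesis
      using S(3)[of m] by (simp add: less_top top_unique)
  qed
  have AS: "A \<inter> S m \<in> sets M" for m
    using S(1) A by auto
  have "\<exists>B. compact B \<and> B \<subseteq> A \<inter> S m \<and> emeasure M (A \<inter> S m - B) < ennreal (1 / Suc k) \<and>
          (\<forall>i\<in>I. multi_lsc_on B (\<lambda>t. epi (fam i t)))" for m k
    using lusin[unfolded uniform_lusin_family_def, rule_format, of "1 / Suc k" "A \<inter> S m"] fin AS
    by simp
  then obtain B where B: "\<And>m k. compact (B m k)" "\<And>m k. B m k \<subseteq> A \<inter> S m"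
    "\<And>m k. emeasure M (A \<inter> S m - B m k) < ennreal (1 / Suc k)"
    "\<And>m k i. i \<in> I \<Longrightarrow> multi_lsc_on (B m k) (\<lambda>t. epi (fam i t))"
    by metis
  have Bs: "B m k \<in> sets M" for m k
    using B(1)[of m k] borel by (meson borel_compact subsetD)
  have null: "A \<inter> S m - (\<Union>k. B m k) \<in> null_sets M" for m
  proof (rule null_setsI)
    show "A \<inter> S m - (\<Union>k. B m k) \<in> sets M"
      using AS Bs by auto
    have "emeasure M (A \<inter> S m - (\<Union>k. B m k)) \<le> ennreal (1 / Suc k)" for k
    proof -
      have "emeasure M (A \<inter> S m - (\<Union>k. B m k)) \<le> emeasure M (A \<inter> S m - B m k)"
        using AS Bs by (intro emeasure_mono) auto
      thus ?thesis
        using B(3)[of m k] by simp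
    qed
    moreover have "(\<lambda>k. ennreal (1 / Suc k)) \<longlonglongrightarrow> ennreal 0"
      using LIMSEQ_inverse_real_of_nat by (intro tendsto_ennrealI) (simp add: inverse_eq_divide)
    ultimately have "emeasure M (A \<inter> S m - (\<Union>k. B m k)) \<le> ennreal 0"
      by (intro LIMSEQ_le_const) auto
    thus "emeasure M (A \<inter> S m - (\<Union>k. B m k)) = 0"
      by simp
  qed
  let ?\<K> = "range (\<lambda>(m, k). B m k)"
  show ?thesis
  proof
    show "countable ?\<K>"
      by simp
    show "compact C \<and> C \<subseteq> A \<and> (\<forall>i\<in>I. multi_lsc_on C (\<lambda>t. epi (fam i t)))" if "C \<in> ?\<K>" for C
      using that B(1,2,4) by fastforce
    have "A - \<Union>?\<K> \<in> sets M"
      using A Bs by (intro sets.Diff sets.countable_Union) auto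
    moreover have "A - \<Union>?\<K> \<subseteq> (\<Union>m. A \<inter> S m - (\<Union>k. B m k))"
      using S(2) sets.sets_into_space[OF A] by fastforce
    moreover have "(\<Union>m. A \<inter> S m - (\<Union>k. B m k)) \<in> null_sets M"
      using null by (rule null_sets_UN)
    ultimately show "A - \<Union>?\<K> \<in> null_sets M"
      using null_sets_subset by blast
  qed
qed

section \<open>Sublevel sets of admissible integrands\<close>

lemma closure_epi_Inf_iff:
  fixes \<phi> :: "'i \<Rightarrow> 'x::metric_space \<Rightarrow> ereal"
  assumes epi: "epi f = closure (epi (\<lambda>x. INF i\<in>I. \<phi> i x))"
  shows "(INF x. f x) < a \<longleftrightarrow> (\<exists>x. \<exists>i\<in>I. \<phi> i x < a)"
proof
  assume "(INF x. f x) < a"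
  then obtain x where "f x < a"
    by (auto simp: INF_less_iff)
  then obtain q where q: "f x < ereal q" "ereal q < a"
    using ereal_dense2 by blast
  then obtain r where r: "f x < ereal r" "ereal r < ereal q"
    using ereal_dense2 by blast
  have "(x, r) \<in> closure (epi (\<lambda>x. INF i\<in>I. \<phi> i x)) \<inter> (UNIV \<times> {..<q})"
    using r by (simp add: epi[symmetric]) (simp add: epi_def)
  moreover have "open (UNIV \<times> {..<q} :: ('x \<times> real) set)"
    by (intro open_Times) auto
  ultimately have "epi (\<lambda>x. INF i\<in>I. \<phi> i x) \<inter> (UNIV \<times> {..<q}) \<noteq> {}"
    by (metis closure_iff_nhds_not_empty IntE Int_commute empty_iff subset_refl)
  then obtain y s where "(INF i\<in>I. \<phi> i y) \<le> ereal s" "s < q"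
    by (auto simp: epi_def)
  hence "(INF i\<in>I. \<phi> i y) < a"
    using q(2) by (meson ereal_less_le less_ereal.simps(1) less_trans order.strict_trans1)
  thus "\<exists>x. \<exists>i\<in>I. \<phi> i x < a"
    by (auto simp: INF_less_iff)
next
  assume "\<exists>x. \<exists>i\<in>I. \<phi> i x < a"
  then obtain x i q where "i \<in> I" "\<phi> i x < ereal q" "ereal q < a"
    using ereal_dense2 by metis
  moreover from this have "(INF i\<in>I. \<phi> i x) \<le> ereal q"
    by (meson INF_lower2 less_imp_le)
  hence "(x, q) \<in> epi f"
    unfolding epi by (intro subsetD[OF closure_subset]) (simp add: epi_def)
  ultimately show "(INF x. f x) < a"
    by (auto simp: epi_def INF_less_iff intro: order.strict_trans1)
qed

text \<open>
  Strict sublevel points of the family lift to points \<open>(x, a)\<close> of the closed set \<open>epi f\<close> at the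
  fixed height \<open>a\<close>, so closedness passes to limits in \<open>x\<close>.
\<close>
lemma closure_strict_sublevel_le:
  fixes \<phi> :: "'i \<Rightarrow> 'x::metric_space \<Rightarrow> ereal"
  assumes epi: "epi f = closure (epi (\<lambda>x. INF i\<in>I. \<phi> i x))"
    and x: "x \<in> closure {x. \<exists>i\<in>I. \<phi> i x < a}"
  shows "f x \<le> a"
proof (cases a)
  case (real r)
  obtain y where y: "\<And>n. y n \<in> {x. \<exists>i\<in>I. \<phi> i x < a}" "y \<longlonglongrightarrow> x"
    using x unfolding closure_sequential by blast
  have "(y n, r) \<in> epi (\<lambda>x. INF i\<in>I. \<phi> i x)" for n
    using y(1)[of n] real by (auto simp: epi_def intro: INF_lower2 less_imp_le)
  moreover have "(\<lambda>n. (y n, r)) \<longlonglongrightarrow> (x, r)"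
    using y(2) by (intro tendsto_intros)
  ultimately have "(x, r) \<in> epi f"
    unfolding epi closure_sequential by (intro exI[of _ "\<lambda>n. (y n, r)"]) simp
  thus ?thesis
    using real by (simp add: epi_def)
qed (use x in auto)

text \<open>
  Meeting \<open>V\<close> in a point of value below \<open>q\<close> means that the epigraph meets the open set
  \<open>V \<times> {..<q}\<close>.
\<close>
lemma multi_lsc_on_epi_sublevel:
  fixes \<phi> :: "'t::topological_space \<Rightarrow> 'x::topological_space \<Rightarrow> ereal"
  assumes lsc: "multi_lsc_on B (\<lambda>t. epi (\<phi> t))" and t: "t \<in> B"
    and V: "open V" "y \<in> V" and less: "\<phi> t y < ereal q"
  obtains U where "openin (top_of_set B) U" "t \<in> U" "\<And>s. s \<in> U \<Longrightarrow> \<exists>x\<in>V. \<phi> s x < ereal q"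
proof -
  obtain r where r: "\<phi> t y < ereal r" "r < q"
    using ereal_dense2[OF less] by auto
  have "(y, r) \<in> epi (\<phi> t) \<inter> V \<times> {..<q}"
    using r V by (auto simp: epi_def)
  moreover have "open (V \<times> {..<q})"
    using V(1) by (intro open_Times) auto
  moreover have "multi_lsc_at B (\<lambda>t. epi (\<phi> t)) t"
    using lsc t calculation(1) unfolding multi_lsc_on_def by fast
  ultimately have "\<exists>U. openin (top_of_set B) U \<and> t \<in> U \<and> (\<forall>s\<in>U. epi (\<phi> s) \<inter> V \<times> {..<q} \<noteq> {})"
    unfolding multi_lsc_at_def by (metis emptyE)
  then obtain U where U: "openin (top_of_set B) U" "t \<in> U"
    "\<And>s. s \<in> U \<Longrightarrow> epi (\<phi> s) \<inter> V \<times> {..<q} \<noteq> {}"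
    by metis
  have "\<exists>x\<in>V. \<phi> s x < ereal q" if "s \<in> U" for s
  proof -
    obtain x p where "x \<in> V" "\<phi> s x \<le> ereal p" "p < q"
      using U(3)[OF \<open>s \<in> U\<close>] by (auto simp: epi_def)
    thus ?thesis
      by (meson le_less_trans less_ereal.simps(1))
  qed
  with U(1,2) show ?thesis
    using that by blast
qed

section \<open>Measurable almost minimizers\<close>

theorem theorem5p4:
  fixes M :: "'t::metric_space measure"
    and f :: "'t \<Rightarrow> 'x::banach \<Rightarrow> ereal"
    and A :: "'t set"
    and \<alpha> :: "'t \<Rightarrow> ereal"
  assumes "complete_measure M"
    and "sigma_finite_measure M"
    and "space M = UNIV"
    and "sets borel \<subseteq> sets M"
    and "inner_regular M"
    and "admissible_integrand M f"
    and "A \<in> sets M"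
    and "\<alpha> \<in> borel_measurable (restrict_space M A)"
    and "\<And>t. t \<in> A \<Longrightarrow> m_inf f t < \<alpha> t"
  shows "\<exists>x :: 't \<Rightarrow> 'x. strongly_measurable (restrict_space M A) x \<and>
           (AE t in M. t \<in> A \<longrightarrow> f t (x t) \<le> \<alpha> t)"
proof -
  obtain I :: "('t \<Rightarrow> 'x \<Rightarrow> ereal) set" and fam where
    lusin: "uniform_lusin_family M I fam" and
    epi: "\<And>t. epi (f t) = closure (epi (\<lambda>x. INF i\<in>I. fam i t x))"
    using assms(6)[unfolded admissible_integrand_def] by (elim exE conjE) (rule that; simp)
  obtain \<K> where \<K>: "countable \<K>" "\<And>B. B \<in> \<K> \<Longrightarrow> compact B" "\<And>B. B \<in> \<K> \<Longrightarrow> B \<subseteq> A"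
    "\<And>B i. B \<in> \<K> \<Longrightarrow> i \<in> I \<Longrightarrow> multi_lsc_on B (\<lambda>t. epi (fam i t))"
    and null: "A - \<Union>\<K> \<in> null_sets M"
    using uniform_lusin_family_exhaustion[OF assms(2,4) lusin assms(7)] by metis
  have "\<exists>\<B>. countable \<B> \<and> (\<forall>b\<in>\<B>. open b) \<and> (\<forall>U t. openin (top_of_set B) U \<longrightarrow> t \<in> U \<longrightarrow>
          (\<exists>b\<in>\<B>. t \<in> b \<and> b \<inter> B \<subseteq> U))" if "B \<in> \<K>" for B
    using compact_countable_base[OF \<K>(2)[OF that]] by metis
  then obtain \<B> where \<B>: "\<And>B. B \<in> \<K> \<Longrightarrow> countable (\<B> B)"
    "\<And>B b. B \<in> \<K> \<Longrightarrow> b \<in> \<B> B \<Longrightarrow> open b"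
    "\<And>B U t. B \<in> \<K> \<Longrightarrow> openin (top_of_set B) U \<Longrightarrow> t \<in> U \<Longrightarrow> \<exists>b\<in>\<B> B. t \<in> b \<and> b \<inter> B \<subseteq> U"
    by metis
  let ?N = "restrict_space M A"
  have space: "space ?N = A"
    using assms(3) by (simp add: space_restrict_space)
  define \<Phi> where
    "\<Phi> t = (if t \<in> \<Union>\<K> then {x. \<exists>i\<in>I. fam i t x < \<alpha> t} else {0})" for t
  define piece where "piece B b q = B \<inter> b \<inter> {t \<in> A. ereal (of_rat q) < \<alpha> t}" for B b q
  \<comment> \<open>On the exceptional null set \<open>\<Phi>\<close> is constant, so that set is itself a suitable piece.\<close>
  define \<C> where "\<C> = insert (A - \<Union>\<K>) (\<Union>B\<in>\<K>. \<Union>b\<in>\<B> B. range (piece B b))"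
  have "countable \<C>"
    using \<K>(1) \<B>(1) by (auto simp: \<C>_def)
  have sets_N: "C \<in> sets ?N" if "C \<in> sets M" "C \<subseteq> A" for C
    using that assms(7) by (simp add: sets_restrict_space_iff)
  have "piece B b q \<in> sets ?N" if "B \<in> \<K>" "b \<in> \<B> B" for B b q
  proof -
    have "B \<inter> b \<in> sets M"
      using \<K>(2)[OF that(1)] \<B>(2)[OF that] assms(4)
      by (meson borel_compact borel_open sets.Int subsetD)
    hence "B \<inter> b \<in> sets ?N"
      using \<K>(3)[OF that(1)] by (intro sets_N) auto
    moreover have "{t \<in> space ?N. ereal (of_rat q) < \<alpha> t} \<in> sets ?N"
      using assms(8) by measurable
    ultimately show ?thesis
      unfolding piece_def space by (rule sets.Int)
  qed
  hence \<C>_sets: "C \<in> sets ?N" if "C \<in> \<C>" for C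
    using that null sets_N[of "A - \<Union>\<K>"] by (auto simp: \<C>_def)
  have \<Phi>_lsc: "\<exists>C\<in>\<C>. t \<in> C \<and> (\<forall>s\<in>C. \<Phi> s \<inter> ball y e \<noteq> {})"
    if t: "t \<in> A" and y: "y \<in> \<Phi> t" and "e > 0" for t y e
  proof (cases "t \<in> \<Union>\<K>")
    case False
    hence "\<forall>s\<in>A - \<Union>\<K>. \<Phi> s \<inter> ball y e \<noteq> {}"
      using y \<open>e > 0\<close> by (auto simp: \<Phi>_def)
    with False t show ?thesis
      by (auto simp: \<C>_def)
  next
    case True
    then obtain B where B: "B \<in> \<K>" "t \<in> B"
      by blast
    obtain i where i: "i \<in> I" "fam i t y < \<alpha> t"
      using y True by (auto simp: \<Phi>_def)
    obtain q where q: "fam i t y < ereal (of_rat q)" "ereal (of_rat q) < \<alpha> t"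
      using ereal_dense3[OF i(2)] by blast
    obtain U where U: "openin (top_of_set B) U" "t \<in> U"
      "\<And>s. s \<in> U \<Longrightarrow> \<exists>x\<in>ball y e. fam i s x < ereal (of_rat q)"
      using multi_lsc_on_epi_sublevel[OF \<K>(4)[OF B(1) i(1)] B(2) open_ball _ q(1), of y e]
        \<open>e > 0\<close> by auto
    obtain b where b: "b \<in> \<B> B" "t \<in> b" "b \<inter> B \<subseteq> U"
      using \<B>(3)[OF B(1) U(1,2)] by blast
    have "\<Phi> s \<inter> ball y e \<noteq> {}" if s: "s \<in> piece B b q" for s
    proof -
      have "s \<in> U" "s \<in> \<Union>\<K>" "ereal (of_rat q) < \<alpha> s"
        using s b(3) B(1) by (auto simp: piece_def)
      moreover from this obtain x where "x \<in> ball y e" "fam i s x < ereal (of_rat q)"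
        using U(3) by blast
      ultimately have "x \<in> \<Phi> s"
        using i(1) by (auto simp: \<Phi>_def intro: less_trans)
      with \<open>x \<in> ball y e\<close> show ?thesis
        by blast
    qed
    moreover have "piece B b q \<in> \<C>"
      unfolding \<C>_def using B(1) b(1) by blast
    moreover have "t \<in> piece B b q"
      using B(2) b(2) q(2) t by (simp add: piece_def)
    ultimately show ?thesis
      by blast
  qed
  have \<Phi>_ne: "\<Phi> t \<noteq> {}" if "t \<in> A" for t
    using assms(9)[OF that] closure_epi_Inf_iff[OF epi, of t "\<alpha> t"]
    by (auto simp: \<Phi>_def m_inf_def)
  have range: "range (from_nat_into \<C>) = \<C>"
    using \<open>countable \<C>\<close> by (intro range_from_nat_into) (auto simp: \<C>_def)
  obtain x where x: "strongly_measurable ?N x" "\<And>t. t \<in> A \<Longrightarrow> x t \<in> closure (\<Phi> t)"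
  proof (rule measurable_selection_of_closure[of "from_nat_into \<C>" ?N \<Phi>])
    show "from_nat_into \<C> k \<in> sets ?N" for k
      using \<C>_sets range by blast
    show "\<exists>k. t \<in> from_nat_into \<C> k \<and> (\<forall>s\<in>from_nat_into \<C> k. \<Phi> s \<inter> ball y e \<noteq> {})"
      if "t \<in> space ?N" "y \<in> \<Phi> t" "e > 0" for t y e
      using \<Phi>_lsc[of t y e] that unfolding space by (metis range imageE)
  qed (use \<Phi>_ne space in auto)
  have "AE t in M. t \<notin> A - \<Union>\<K>"
    using null by (rule AE_not_in)
  hence "AE t in M. t \<in> A \<longrightarrow> f t (x t) \<le> \<alpha> t"
  proof (rule eventually_mono, intro impI)
    fix t assume "t \<notin> A - \<Union>\<K>" "t \<in> A"
    hence "x t \<in> closure {x. \<exists>i\<in>I. fam i t x < \<alpha> t}"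
      using x(2)[of t] by (auto simp: \<Phi>_def)
    thus "f t (x t) \<le> \<alpha> t"
      by (rule closure_strict_sublevel_le[OF epi])
  qed
  with x(1) show ?thesis
    by blast
qed

end
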